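(* Let $X$ be a nonempty complete metric space without isolated points and let $f,g:X\to\mathbb{R}$ be two real-valued functions. If $C(f)$ and $C(g)$ are dense in $X$, then $C(f)\cap C(g)$ is an uncountable dense subset of $X$.
   Context: For a function $f:X\to\mathbb{R}$ on a metric space $X$, $C(f)$ denotes the set of points $x\in X$ at which $f$ is continuous (as a function on all of $X$). *)

theory Defs
  imports "HOL-Analysis.Analysis"
begin

text \<open>
  A metric space is a set \<open>X\<close> in a type of class \<open>metric_space\<close>, with the induced metric.
  Functions on \<open>X\<close> are total in HOL, so continuity is relative to \<open>X\<close>: values outside \<open>X\<close>
  play no role.
\<close>

definition continuity_points ::
    "'a::metric_space set \<Rightarrow> ('a \<Rightarrow> 'b::topological_space) \<Rightarrow> 'a set" where
  "continuity_points X f = {x \<in> X. continuous (at x within X) f}"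

text \<open>As \<open>D \<subseteq> X\<close>, the closure of \<open>D\<close> in the subspace \<open>X\<close> is \<open>X \<inter> closure D\<close>.\<close>

definition dense_subset :: "'a::topological_space set \<Rightarrow> 'a set \<Rightarrow> bool" where
  "dense_subset D X \<longleftrightarrow> D \<subseteq> X \<and> X \<subseteq> closure D"

end

theory Submission
  imports Defs
begin

text \<open>
  The points of continuity of a map into a metric space form a G-delta set, as the intersection of
  the open sets of points where the oscillation is below \<open>1/n\<close>. By the Baire category theorem, two
  dense G-delta sets in a complete space have dense intersection. If a dense G-delta set \<open>S\<close> were
  countable, then, as there are no isolated points, its complement would also be a dense G-delta
  set, although it is disjoint from \<open>S\<close>.
\<close>

text \<open>Puts completeness in the form required by \<open>Baire_category\<close>, which speaks of
  abstract topologies: a Cauchy sequence of the submetric on \<open>X\<close> is a Cauchy sequence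
  in \<open>X\<close>, with the same limits.\<close>

lemma completely_metrizable_space_complete:
  fixes X :: "'a::metric_space set"
  assumes "complete X"
  shows "completely_metrizable_space (top_of_set X)"
proof -
  interpret Submetric UNIV dist X
    by unfold_locales simp
  have "sub.mcomplete"
    using assms
    by (auto simp: sub.mcomplete_def MCauchy_submetric complete_def limitin_submetric_iff
        limitin_iff_tendsto image_subset_iff)
  then show ?thesis
    using sub.completely_metrizable_space_mtopology mtopology_submetric by simp
qed

lemma dense_subset_iff_closure_of:
  "dense_subset D X \<longleftrightarrow> D \<subseteq> X \<and> top_of_set X closure_of D = X"
  by (auto simp: dense_subset_def closure_of_subtopology Int_absorb1)

lemma dense_subset_mono:
  assumes "dense_subset D X" "D \<subseteq> E" "E \<subseteq> X"
  shows "dense_subset E X"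
  using assms closure_mono unfolding dense_subset_def by blast

text \<open>The Baire category theorem for a complete set. The factor \<open>X\<close> covers the
  empty family, whose intersection is the whole type.\<close>

lemma dense_subset_Inter:
  fixes X :: "'a::metric_space set"
  assumes "complete X" "countable \<G>"
    and "\<And>T. T \<in> \<G> \<Longrightarrow> openin (top_of_set X) T \<and> dense_subset T X"
  shows "dense_subset (X \<inter> \<Inter>\<G>) X"
proof -
  have "top_of_set X closure_of \<Inter>\<G> = X"
    using Baire_category[of "top_of_set X" \<G>] assms
    by (auto simp: completely_metrizable_space_complete dense_subset_iff_closure_of)
  then show ?thesis
    by (metis closure_of_restrict dense_subset_iff_closure_of inf_le1 topspace_euclidean_subtopology)
qed

text \<open>Every open set in a family with intersection \<open>S\<close> contains \<open>S\<close>,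
  so it inherits density from \<open>S\<close>.\<close>

lemma gdelta_in_dense_subsetE:
  assumes "gdelta_in (top_of_set X) S" "dense_subset S X"
  obtains \<G> where "countable \<G>" "S = X \<inter> \<Inter>\<G>"
    "\<And>T. T \<in> \<G> \<Longrightarrow> openin (top_of_set X) T \<and> dense_subset T X"
proof -
  obtain \<G> where \<G>: "countable \<G>" "\<And>T. T \<in> \<G> \<Longrightarrow> openin (top_of_set X) T" "S = X \<inter> \<Inter>\<G>"
    using assms(1)
    unfolding gdelta_in_def relative_to_def intersection_of_def by auto
  show thesis
  proof
    show "openin (top_of_set X) T \<and> dense_subset T X" if "T \<in> \<G>" for T
    proof
      show "openin (top_of_set X) T" using \<G> that by blast
      then show "dense_subset T X"
        using \<G>(3) that by (intro dense_subset_mono[OF assms(2)]) (auto dest: openin_imp_subset)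
    qed
  qed (use \<G> in auto)
qed

lemma dense_subset_gdelta_Int:
  fixes X :: "'a::metric_space set"
  assumes "complete X"
    and S: "gdelta_in (top_of_set X) S" "dense_subset S X"
    and T: "gdelta_in (top_of_set X) T" "dense_subset T X"
  shows "dense_subset (S \<inter> T) X"
proof -
  obtain \<G> where \<G>: "countable \<G>" "S = X \<inter> \<Inter>\<G>"
    "\<And>U. U \<in> \<G> \<Longrightarrow> openin (top_of_set X) U \<and> dense_subset U X"
    using gdelta_in_dense_subsetE[OF S] by metis
  obtain \<H> where \<H>: "countable \<H>" "T = X \<inter> \<Inter>\<H>"
    "\<And>U. U \<in> \<H> \<Longrightarrow> openin (top_of_set X) U \<and> dense_subset U X"
    using gdelta_in_dense_subsetE[OF T] by metis
  \<comment> \<open>The union of the two countable families is again a countable family of dense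
    open sets, so one use of Baire suffices.\<close>
  have "dense_subset (X \<inter> \<Inter>(\<G> \<union> \<H>)) X"
    using \<G> \<H> by (intro dense_subset_Inter \<open>complete X\<close>) auto
  moreover have "S \<inter> T = X \<inter> \<Inter>(\<G> \<union> \<H>)"
    using \<G>(2) \<H>(2) by auto
  ultimately show ?thesis by simp
qed

text \<open>If \<open>x\<close> lies in \<open>X\<close>, it is a limit point of \<open>X\<close>,
  hence of \<open>X - {x}\<close>; otherwise nothing is removed.\<close>

lemma dense_subset_delete:
  fixes X :: "'a::t1_space set"
  assumes "\<not> x isolated_in X"
  shows "dense_subset (X - {x}) X"
  using assms
  by (auto simp: dense_subset_def isolated_in_islimpt_iff closure_def islimpt_punctured[symmetric])

lemma uncountable_dense_gdelta:
  fixes X :: "'a::metric_space set"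
  assumes "complete X" "X \<noteq> {}" "\<And>x. \<not> x isolated_in X"
    and S: "gdelta_in (top_of_set X) S" "dense_subset S X"
  shows "uncountable S"
proof
  assume "countable S"
  \<comment> \<open>These punctured copies of \<open>X\<close> are open and dense, and
    \<open>X \<inter> \<Inter>\<G>\<close> is the complement \<open>X - S\<close>.\<close>
  define \<G> where "\<G> = (\<lambda>x. X - {x}) ` S"
  have \<G>: "countable \<G>" "\<And>T. T \<in> \<G> \<Longrightarrow> openin (top_of_set X) T \<and> dense_subset T X"
    using \<open>countable S\<close> assms(3)
    by (auto simp: \<G>_def dense_subset_delete intro!: openin_delete)
  have "gdelta_in (top_of_set X) (X \<inter> \<Inter>\<G>)"
    unfolding gdelta_in_def relative_to_def intersection_of_def using \<G> by auto
  then have "dense_subset (S \<inter> (X \<inter> \<Inter>\<G>)) X"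
    using dense_subset_gdelta_Int[OF \<open>complete X\<close> S] dense_subset_Inter[OF \<open>complete X\<close> \<G>] by blast
  moreover have "S \<inter> (X \<inter> \<Inter>\<G>) = {}"
    by (auto simp: \<G>_def)
  ultimately show False
    using \<open>X \<noteq> {}\<close> by (simp add: dense_subset_def)
qed

lemma gdelta_in_continuity_points:
  fixes f :: "'a::metric_space \<Rightarrow> 'b::metric_space"
  shows "gdelta_in (top_of_set X) (continuity_points X f)"
proof -
  \<comment> \<open>The points of \<open>X\<close> with a relative neighbourhood on which any two
    values of \<open>f\<close> differ by less than \<open>1/(n+1)\<close>. As a union of open sets,
    \<open>A n\<close> is open whether or not \<open>f\<close> is continuous anywhere.\<close>
  define A where "A n = \<Union>{U. openin (top_of_set X) U \<and>
      (\<forall>x\<in>U. \<forall>y\<in>U. dist (f x) (f y) < inverse (real (Suc n)))}" for n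
  have A: "openin (top_of_set X) (A n)" for n
    unfolding A_def by (rule openin_Union) auto
  have "continuity_points X f = X \<inter> (\<Inter>n. A n)"
  proof (intro equalityI subsetI IntI INT_I)
    fix x n assume "x \<in> continuity_points X f"
    then have x: "x \<in> X" "continuous (at x within X) f"
      by (auto simp: continuity_points_def)
    \<comment> \<open>Half the bound, since two values near \<open>x\<close> are compared through
      \<open>f x\<close>.\<close>
    have e: "inverse (real (Suc n)) / 2 > 0" (is "?e > 0") by simp
    then obtain d where "d > 0" and d: "\<And>y. y \<in> X \<Longrightarrow> dist y x < d \<Longrightarrow> dist (f y) (f x) < ?e"
      using x(2) unfolding continuous_within_eps_delta by blast
    have "dist (f y) (f z) < inverse (real (Suc n))"
      if "y \<in> X \<inter> ball x d" "z \<in> X \<inter> ball x d" for y z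
    proof (rule dist_triangle_half_l)
      show "dist (f y) (f x) < ?e" "dist (f z) (f x) < ?e"
        using that by (auto intro!: d simp only: Int_iff mem_ball dist_commute[of x])
    qed
    moreover have "openin (top_of_set X) (X \<inter> ball x d)" "x \<in> X \<inter> ball x d"
      using x \<open>d > 0\<close> by (auto simp: openin_open_Int)
    ultimately show "x \<in> A n"
      unfolding A_def by blast
  next
    fix x assume "x \<in> X \<inter> (\<Inter>n. A n)"
    then have "x \<in> X" and xA: "\<And>n. x \<in> A n" by auto
    have "\<exists>d>0. \<forall>y\<in>X. dist y x < d \<longrightarrow> dist (f y) (f x) < e" if "e > 0" for e
    proof -
      obtain n where n: "inverse (real (Suc n)) < e"
        using reals_Archimedean[OF \<open>e > 0\<close>] by blast
      \<comment> \<open>One of the two points in the oscillation bound is taken to be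
        \<open>x\<close> itself.\<close>
      obtain U where U: "openin (top_of_set X) U" "x \<in> U"
        "\<And>y. y \<in> U \<Longrightarrow> dist (f y) (f x) < inverse (real (Suc n))"
        using xA[of n] unfolding A_def by blast
      then obtain d where "d > 0" "\<And>y. y \<in> X \<Longrightarrow> dist y x < d \<Longrightarrow> y \<in> U"
        unfolding openin_euclidean_subtopology_iff by blast
      then show ?thesis
        using U(3) n by (meson less_trans)
    qed
    then show "x \<in> continuity_points X f"
      using \<open>x \<in> X\<close> by (simp add: continuity_points_def continuous_within_eps_delta)
  qed (auto simp: continuity_points_def)
  moreover have "gdelta_in (top_of_set X) (\<Inter>n. A n)"
    by (rule gdelta_in_Inter) (auto intro: open_imp_gdelta_in A)
  moreover have "gdelta_in (top_of_set X) X"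
    using gdelta_in_topspace[of "top_of_set X"] by simp
  ultimately show ?thesis
    by (simp add: gdelta_in_Int)
qed

theorem theorem2:
  fixes X :: "'a::metric_space set" and f g :: "'a \<Rightarrow> real"
  assumes "X \<noteq> {}"
    and "complete X"
    and "\<And>x. \<not> x isolated_in X"
    and "dense_subset (continuity_points X f) X"
    and "dense_subset (continuity_points X g) X"
  shows "uncountable (continuity_points X f \<inter> continuity_points X g) \<and>
         dense_subset (continuity_points X f \<inter> continuity_points X g) X"
proof -
  let ?C = "continuity_points X f \<inter> continuity_points X g"
  have "dense_subset ?C X"
    using assms by (intro dense_subset_gdelta_Int gdelta_in_continuity_points)
  \<comment> \<open>The intersection is itself a dense G-delta set, so its uncountability follows
    without returning to \<open>f\<close> and \<open>g\<close>.\<close>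
  moreover have "gdelta_in (top_of_set X) ?C"
    by (intro gdelta_in_Int gdelta_in_continuity_points)
  ultimately show ?thesis
    by (intro conjI uncountable_dense_gdelta[OF assms(2,1,3)])
qed

end
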